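(* Let $n\ge 0$ be an integer and let $q,a,b$ be nonzero complex parameters such that no denominator occurring below vanishes. Then $$ {}_4\phi_3\left[\begin{array}{c} q^{-2n},\, a,\, b,\, q^{-1-2n}/ab \\ q^{-2n}/a,\, q^{-2n}/b,\, abq\end{array};q^2,\,q^2\right] =\frac{(aq,bq,-q;q)_n\,(abq^2;q^2)_{n}}{(abq;q)_{n}\,(aq^2,bq^2;q^2)_{n}}. $$
   Context: For an integer $n\ge 0$, $(x;q)_n=\prod_{i=0}^{n-1}(1-xq^i)$ (so $(x;q)_0=1$), and $(x_1,\ldots,x_m;q)_n=\prod_{i=1}^m (x_i;q)_n$; $(x;q^2)_n$ is the same with $q$ replaced by $q^2$. The basic hypergeometric series is $${}_4\phi_3\left[\begin{array}{c} a_1,a_2,a_3,a_4\\ b_1,b_2,b_3\end{array};q,z\right]=\sum_{k\ge 0}\frac{(a_1,a_2,a_3,a_4;q)_k\,z^k}{(q,b_1,b_2,b_3;q)_k}.$$ In the claim the base is $q^2$ (replace $q$ by $q^2$ in the definition) and $a_1=q^{-2n}$, so the series terminates: it denotes the finite sum over $0\le k\le n$. Here $q^{c}/ab$ means $q^{c}/(ab)$. The identity is to be understood as an identity of rational functions in $a,b,q$, i.e. valid whenever no denominator vanishes. *)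

theory Defs
  imports Complex_Main
begin

definition qpoch :: "complex \<Rightarrow> complex \<Rightarrow> nat \<Rightarrow> complex" where
  "qpoch x q n = (\<Prod>i<n. 1 - x * q ^ i)"

definition qpochs :: "complex list \<Rightarrow> complex \<Rightarrow> nat \<Rightarrow> complex" where
  "qpochs xs q n = (\<Prod>x\<leftarrow>xs. qpoch x q n)"

definition phi43 ::
  "complex \<Rightarrow> complex \<Rightarrow> complex \<Rightarrow> complex \<Rightarrow> complex \<Rightarrow> complex \<Rightarrow> complex \<Rightarrow> complex \<Rightarrow> complex \<Rightarrow> complex"
where
  "phi43 a1 a2 a3 a4 b1 b2 b3 q z =
     (\<Sum>k. qpochs [a1, a2, a3, a4] q k * z ^ k / qpochs [q, b1, b2, b3] q k)"

text \<open>
  When \<open>a1 = Q\<close> to the power \<open>-n\<close> (base \<open>Q\<close>), every numerator with \<open>k > n\<close> vanishes, so the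
  series is the finite sum over \<open>k \<le> n\<close>; since \<open>0 / x = 0\<close> also for \<open>x = 0\<close>, this needs no
  condition on the denominators beyond \<open>n\<close>.
\<close>

lemma phi43_terminating:
  assumes "Q \<noteq> 0"
  shows "phi43 (Q powi (- int n)) a2 a3 a4 b1 b2 b3 Q z =
     (\<Sum>k\<le>n. qpochs [Q powi (- int n), a2, a3, a4] Q k * z ^ k / qpochs [Q, b1, b2, b3] Q k)"
proof -
  have "qpoch (Q powi (- int n)) Q k = 0" if "k > n" for k
  proof -
    have "1 - Q powi (- int n) * Q ^ n = 0"
      using assms by (simp add: power_int_minus)
    with that show ?thesis
      unfolding qpoch_def by (intro prod_zero) auto
  qed
  then show ?thesis
    unfolding phi43_def by (intro suminf_finite) (auto simp: qpochs_def)
qed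

end

theory Submission
  imports Defs "HOL-Computational_Algebra.Polynomial"
begin

text \<open>
  Put \<open>Q = q\<^sup>2\<close>, \<open>e = a b\<close> and \<open>c = e q\<close>. Reversing the factors that contain \<open>Q\<^sup>-\<^sup>n\<close> and
  multiplying by \<open>(a Q, b Q, c; Q)\<^sub>n\<close> turns the identity into one between polynomials
  (\<open>cleared_sum\<close> and \<open>cleared_prod\<close> below). The terms of the sum depend on \<open>a\<close> and \<open>b\<close>
  through \<open>e\<close> and products \<open>(1 - a v) (1 - b v) = 1 - (a + b) v + e v\<^sup>2\<close>, so for fixed \<open>q\<close> and
  \<open>e\<close> both sides are polynomials of degree at most \<open>n\<close> in \<open>a + b\<close>. Hence they agree
  as soon as they agree for the \<open>n + 1\<close> values \<open>a = q\<^sup>-\<^sup>j\<close>, \<open>b = e q\<^sup>j\<close>, \<open>0 \<le> j \<le> n\<close>.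

  For \<open>j = 0\<close> only the term with \<open>k = 0\<close> survives. For \<open>1 \<le> j \<le> n\<close> the product is zero because of
  \<open>(a q; q)\<^sub>n\<close>, and the sum has to vanish. If \<open>j\<close> is even, each term contains a zero factor
  (\<open>cleared_sum_even_eq_0\<close>). If \<open>j\<close> is odd, the quotient \<open>b / c\<close> is an integral power of
  \<open>Q\<close>, and the factors regroup so that the sum becomes an \<open>n\<close>-th \<open>q\<close>-difference of a polynomial
  of degree \<open>n - 1\<close> in \<open>Q\<^sup>-\<^sup>k\<close>, which is zero by the finite \<open>q\<close>-binomial theorem
  (\<open>cleared_sum_odd_eq_0\<close>, \<open>q_difference_eq_0\<close>).

  The \<open>n + 1\<close> values of \<open>a + b\<close> are distinct unless \<open>e q\<^sup>m = 1\<close> for some small \<open>m\<close>; these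
  exceptional cases follow by continuity in \<open>b\<close>.
\<close>

section \<open>Shifted factorials\<close>

lemma qpoch_0 [simp]: "qpoch x Q 0 = 1"
  by (simp add: qpoch_def)

lemma qpoch_Suc: "qpoch x Q (Suc k) = qpoch x Q k * (1 - x * Q ^ k)"
  by (simp add: qpoch_def)

lemma qpoch_add: "qpoch x Q (m + k) = qpoch x Q m * qpoch (x * Q ^ m) Q k"
  by (induction k) (simp_all add: qpoch_Suc power_add mult_ac)

lemma qpoch_split: "k \<le> n \<Longrightarrow> qpoch x Q n = qpoch x Q k * qpoch (x * Q ^ k) Q (n - k)"
  using qpoch_add[of x Q k "n - k"] by simp

lemma qpoch_Suc_left: "qpoch x Q (Suc k) = (1 - x) * qpoch (x * Q) Q k"
  using qpoch_add[of x Q 1 k] by (simp add: qpoch_def)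

lemma qpoch_eq_0: "x * Q ^ i = 1 \<Longrightarrow> i < k \<Longrightarrow> qpoch x Q k = 0"
  unfolding qpoch_def by (rule prod_zero) auto

lemma qpoch_nonzero_le: "qpoch x Q n \<noteq> 0 \<Longrightarrow> k \<le> n \<Longrightarrow> qpoch x Q k \<noteq> 0"
  by (auto simp: qpoch_split)

lemma qpoch_nonzero_factor: "qpoch x Q n \<noteq> 0 \<Longrightarrow> i < n \<Longrightarrow> x * Q ^ i \<noteq> 1"
  using qpoch_eq_0 by blast

lemma continuous_qpoch [continuous_intros]:
  "continuous F f \<Longrightarrow> continuous F (\<lambda>x. qpoch (f x) Q k)"
  unfolding qpoch_def by (intro continuous_intros)

text \<open>
  Each shifted factorial runs over a segment of one geometric progression. The hypothesis says that
  the segment of length \<open>k\<close> from \<open>y\<close> and that of length \<open>M\<close> from \<open>x\<close> end at the same place;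
  so the two sides differ only by exchanging the end points of two overlapping or adjacent segments.
\<close>
lemma qpoch_exchange:
  assumes "Q \<noteq> 0" "y * Q ^ k = x * Q ^ M" "k \<le> n" "M \<le> n"
  shows "qpoch y Q k * qpoch x Q (n - k) = qpoch x Q M * qpoch y Q (n - M)"
proof (cases "k \<le> M")
  case True
  then have "y = x * Q ^ (M - k)"
    using assms(1,2) by (simp add: power_diff field_simps)
  moreover have "qpoch x Q M = qpoch x Q (M - k) * qpoch (x * Q ^ (M - k)) Q k"
    using qpoch_split[of "M - k" M x Q] True by simp
  moreover have "qpoch x Q (n - k) = qpoch x Q (M - k) * qpoch (x * Q ^ (M - k)) Q (n - M)"
    using qpoch_split[of "M - k" "n - k" x Q] True assms by simp
  ultimately show ?thesis by simp
next
  case False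
  then have "x = y * Q ^ (k - M)"
    using assms(1,2) by (simp add: power_diff field_simps)
  moreover have "qpoch y Q k = qpoch y Q (k - M) * qpoch (y * Q ^ (k - M)) Q M"
    using qpoch_split[of "k - M" k y Q] False by simp
  moreover have "qpoch y Q (n - M) = qpoch y Q (k - M) * qpoch (y * Q ^ (k - M)) Q (n - k)"
    using qpoch_split[of "k - M" "n - M" y Q] False assms by simp
  ultimately show ?thesis by simp
qed

lemma choose_two_Suc: "Suc k choose 2 = (k choose 2) + k"
  by (simp add: numeral_2_eq_2)

lemma qpoch_reflect:
  assumes "Q \<noteq> 0" "x \<noteq> 0"
  shows "qpoch (1 / x) Q k = (- 1 / x) ^ k * Q ^ (k choose 2) * qpoch (x * Q / Q ^ k) Q k"
proof (induction k)
  case (Suc k)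
  have "qpoch (x * Q / Q ^ Suc k) Q (Suc k) = (1 - x / Q ^ k) * qpoch (x * Q / Q ^ k) Q k"
    using assms by (simp add: qpoch_Suc_left)
  moreover have "1 - 1 / x * Q ^ k = (- 1 / x) * Q ^ k * (1 - x / Q ^ k)"
    using assms by (simp add: field_simps)
  ultimately show ?case
    by (simp only: qpoch_Suc Suc.IH choose_two_Suc power_add power_Suc mult_ac)
qed (simp add: numeral_2_eq_2)

lemma qpoch_square_split: "qpoch x q (2 * n) = qpoch x (q\<^sup>2) n * qpoch (x * q) (q\<^sup>2) n"
  by (induction n) (simp_all add: qpoch_Suc mult_ac flip: power_mult)

lemma qpoch_times_minus: "qpoch q q n * qpoch (- q) q n = qpoch (q\<^sup>2) (q\<^sup>2) n"
proof (induction n)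
  case (Suc n)
  have "(1 - q * q ^ n) * (1 - - q * q ^ n) = 1 - q\<^sup>2 * (q\<^sup>2) ^ n"
    by (simp add: algebra_simps power2_eq_square power_mult_distrib)
  with Suc show ?case
    by (simp only: qpoch_Suc) (metis (no_types, lifting) mult.assoc mult.left_commute)
qed simp


section \<open>The finite q-binomial theorem\<close>

fun qbin :: "complex \<Rightarrow> nat \<Rightarrow> nat \<Rightarrow> complex" where
  "qbin Q n 0 = 1"
| "qbin Q 0 (Suc k) = 0"
| "qbin Q (Suc n) (Suc k) = qbin Q n k + Q ^ Suc k * qbin Q n (Suc k)"

lemma qbin_eq_0: "n < k \<Longrightarrow> qbin Q n k = 0"
  by (induction Q n k rule: qbin.induct) auto

text \<open>
  The factorial formula for the Gaussian binomial coefficient, with the denominators multiplied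
  out so that it also holds when \<open>Q\<close> is a root of unity.
\<close>
lemma qbin_qpoch:
  "qbin Q (k + l) k * qpoch Q Q k * qpoch Q Q l = qpoch Q Q (k + l)"
proof (induction "k + l" arbitrary: k l)
  case (Suc n)
  show ?case
  proof (cases k)
    case k: (Suc k')
    show ?thesis
    proof (cases l)
      case 0
      have "qbin Q k' k' * qpoch Q Q k' = qpoch Q Q k'"
        using Suc.hyps(1)[of k' 0] Suc.hyps(2) k 0 by simp
      then show ?thesis
        by (simp add: k 0 qbin_eq_0 qpoch_Suc) (metis mult.assoc)
    next
      case l: (Suc l')
      have 1: "qbin Q (k' + l) k' * qpoch Q Q k' * qpoch Q Q l = qpoch Q Q (k' + l)"
        using Suc.hyps(1)[of k' l] Suc.hyps(2) k by simp
      have 2: "qbin Q (k + l') k * qpoch Q Q k * qpoch Q Q l' = qpoch Q Q (k' + l)"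
        using Suc.hyps(1)[of k l'] Suc.hyps(2) k l by simp
      have "qbin Q (k + l) k * qpoch Q Q k * qpoch Q Q l =
          qbin Q (k' + l) k' * qpoch Q Q k' * qpoch Q Q l * (1 - Q * Q ^ k') +
          Q ^ k * (qbin Q (k + l') k * qpoch Q Q k * qpoch Q Q l') * (1 - Q * Q ^ l')"
        by (simp add: k l qpoch_Suc algebra_simps)
      also have "\<dots> = qpoch Q Q (k' + l) * (1 - Q * Q ^ (k' + l))"
        unfolding 1 2 by (simp add: k l algebra_simps power_add)
      finally show ?thesis by (simp add: k qpoch_Suc)
    qed
  qed simp
qed simp

text \<open>
  The induction step compares coefficients in \<open>(z; Q)\<^sub>n\<^sub>+\<^sub>1 = (1 - z) (z Q; Q)\<^sub>n\<close>, which is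
  the Pascal rule defining \<open>qbin\<close>.
\<close>
lemma q_binomial:
  "(\<Sum>k\<le>n. (- 1) ^ k * Q ^ (k choose 2) * qbin Q n k * z ^ k) = qpoch z Q n"
proof (induction n arbitrary: z)
  case (Suc n)
  define t where "t k = (- 1) ^ k * Q ^ (k choose 2) * qbin Q n k * (z * Q) ^ k" for k
  have "(- 1) ^ Suc k * Q ^ (Suc k choose 2) * qbin Q (Suc n) (Suc k) * z ^ Suc k =
      t (Suc k) - z * t k" for k
    by (simp add: t_def choose_two_Suc power_add algebra_simps power_mult_distrib)
  then have "(\<Sum>k\<le>Suc n. (- 1) ^ k * Q ^ (k choose 2) * qbin Q (Suc n) k * z ^ k) =
      1 + (\<Sum>k\<le>n. t (Suc k) - z * t k)"
    unfolding sum.atMost_Suc_shift by (simp only:) (simp add: binomial_eq_0)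
  also have "\<dots> = (t 0 + (\<Sum>k\<le>n. t (Suc k))) - z * (\<Sum>k\<le>n. t k)"
    by (simp add: sum_subtractf sum_distrib_left t_def binomial_eq_0)
  also have "t 0 + (\<Sum>k\<le>n. t (Suc k)) = (\<Sum>k\<le>Suc n. t k)"
    by (rule sum.atMost_Suc_shift[symmetric])
  also have "\<dots> = (\<Sum>k\<le>n. t k)"
    by (simp add: t_def qbin_eq_0)
  also have "(\<Sum>k\<le>n. t k) = qpoch (z * Q) Q n"
    unfolding t_def by (rule Suc.IH)
  finally show ?case by (simp add: qpoch_Suc_left algebra_simps)
qed (simp add: binomial_eq_0)

text \<open>
  By linearity it suffices to treat monomials \<open>x\<^sup>l\<close>, for which the sum is
  \<open>(Q\<^sup>-\<^sup>l; Q)\<^sub>n\<close>; its factor with index \<open>l\<close> vanishes. This is the \<open>q\<close>-analogue of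
  \<open>n\<close>-th differences killing polynomials of degree below \<open>n\<close>.
\<close>
lemma q_difference_eq_0:
  assumes "Q \<noteq> 0" "degree p < n"
  shows "(\<Sum>k\<le>n. (- 1) ^ k * Q ^ (k choose 2) * qbin Q n k * poly p (1 / Q ^ k)) = 0"
proof -
  have "(\<Sum>k\<le>n. (- 1) ^ k * Q ^ (k choose 2) * qbin Q n k * poly p (1 / Q ^ k)) =
     (\<Sum>k\<le>n. \<Sum>l\<le>degree p. coeff p l *
        ((- 1) ^ k * Q ^ (k choose 2) * qbin Q n k * (1 / Q ^ l) ^ k))"
    by (simp add: poly_altdef sum_distrib_left mult_ac power_one_over flip: power_mult)
  also have "\<dots> = (\<Sum>l\<le>degree p. coeff p l * qpoch (1 / Q ^ l) Q n)"
    by (subst sum.swap) (simp only: q_binomial flip: sum_distrib_left)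
  also have "\<dots> = 0"
    using assms by (intro sum.neutral ballI) (auto intro!: qpoch_eq_0[of _ _ "_::nat"])
  finally show ?thesis .
qed


section \<open>The identity cleared of denominators\<close>

text \<open>
  The factor \<open>(c Q\<^sup>k; Q)\<^sub>n\<^sub>-\<^sub>k\<close> with \<open>c = a b q\<close> is \<open>(c; Q)\<^sub>n / (c; Q)\<^sub>k\<close>, and
  \<open>(c Q\<^sup>n\<^sup>-\<^sup>k\<^sup>+\<^sup>1; Q)\<^sub>k\<close> is the reversed \<open>(Q\<^sup>-\<^sup>n / c; Q)\<^sub>k\<close> up to a monomial.
  Likewise \<open>(a Q; Q)\<^sub>n\<^sub>-\<^sub>k\<close> comes from \<open>(Q\<^sup>-\<^sup>n / a; Q)\<^sub>k\<close> in the denominator.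
\<close>
definition cleared_sum :: "complex \<Rightarrow> nat \<Rightarrow> complex \<Rightarrow> complex \<Rightarrow> complex" where
  "cleared_sum q n a b =
     (\<Sum>k\<le>n. qbin (q\<^sup>2) n k * q ^ k
        * (qpoch a (q\<^sup>2) k * qpoch b (q\<^sup>2) k)
        * (qpoch (a * q\<^sup>2) (q\<^sup>2) (n - k) * qpoch (b * q\<^sup>2) (q\<^sup>2) (n - k))
        * (qpoch (a * b * q * (q\<^sup>2) ^ k) (q\<^sup>2) (n - k)
           * qpoch (a * b * q * q\<^sup>2 * (q\<^sup>2) ^ (n - k)) (q\<^sup>2) k))"

definition cleared_prod :: "complex \<Rightarrow> nat \<Rightarrow> complex \<Rightarrow> complex \<Rightarrow> complex" where
  "cleared_prod q n a b =
     qpoch (- q) q n * qpoch (a * b * q ^ Suc n) q n * (qpoch (a * q) q n * qpoch (b * q) q n)"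

lemma degree_prod_linear_le:
  assumes "\<And>i. degree (f i) \<le> 1"
  shows "degree (\<Prod>i<(k::nat). f i) \<le> k"
proof -
  have "degree (\<Prod>i<k. f i) \<le> (\<Sum>i<k. (degree \<circ> f) i)"
    by (rule degree_prod_sum_le) simp
  also have "\<dots> \<le> (\<Sum>i<k. 1)"
    using assms by (intro sum_mono) simp
  finally show ?thesis by simp
qed

text \<open>
  Here \<open>b = c Q\<^sup>m\<close> for \<open>c = a b q\<close>, so the factors in \<open>b\<close> and \<open>c\<close> exchange to leave a constant and two
  products of \<open>m\<close> factors. After reversing \<open>(a; Q)\<^sub>k\<close>, which supplies the sign and the power
  of \<open>Q\<close> of the \<open>q\<close>-binomial theorem, the factors in \<open>a\<close> leave a constant and \<open>n - (2 m + 1)\<close>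
  factors. The remaining power of \<open>Q\<close> is \<open>Q\<^sup>-\<^sup>k\<^sup>m\<close>, just enough to make the product
  \<open>(c Q\<^sup>k; Q)\<^sub>m\<close> a polynomial in \<open>Q\<^sup>-\<^sup>k\<close>. The total degree is \<open>n - 1\<close>.
\<close>
lemma cleared_sum_odd_eq_0:
  assumes q: "q \<noteq> 0" and m: "2 * m + 1 \<le> n"
  shows "cleared_sum q n (1 / q ^ (2 * m + 1)) (e * q ^ (2 * m + 1)) = 0"
proof -
  define Q where "Q = q\<^sup>2"
  define a where "a = 1 / q ^ (2 * m + 1)"
  define c where "c = e * q"
  define b where "b = c * Q ^ m"
  have Q: "Q \<noteq> 0" using q by (simp add: Q_def)
  have Qm: "Q ^ i = q ^ (2 * i)" for i
    by (simp add: Q_def power_mult)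
  have b: "e * q ^ (2 * m + 1) = b"
    by (simp add: b_def c_def Qm)
  have c: "a * b * q = c"
    using q by (simp add: a_def b_def Qm)
  define p where "p = (\<Prod>i<m. [:- c * Q ^ i, 1:])
      * (\<Prod>i<n - (2 * m + 1). [:1, - (q ^ (2 * m + 3) * Q ^ i):])
      * (\<Prod>i<m. [:1, - c * Q * Q ^ n * Q ^ i:])"
  have "degree p \<le> m + (n - (2 * m + 1)) + m"
    unfolding p_def
    by (intro order.trans[OF degree_mult_le] add_mono degree_prod_linear_le) simp_all
  with m have deg: "degree p < n" by linarith
  define K where "K = qpoch (a * Q) Q (2 * m + 1) * qpoch (c * Q ^ m) Q (n - m)
      * qpoch (c * Q * Q ^ m) Q (n - m)"
  have "qbin Q n k * q ^ k * (qpoch a Q k * qpoch b Q k)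
        * (qpoch (a * Q) Q (n - k) * qpoch (b * Q) Q (n - k))
        * (qpoch (c * Q ^ k) Q (n - k) * qpoch (c * Q * Q ^ (n - k)) Q k)
      = K * ((- 1) ^ k * Q ^ (k choose 2) * qbin Q n k * poly p (1 / Q ^ k))"
    if k: "k \<le> n" for k
  proof -
    define y where "y = q ^ (2 * m + 1) * Q / Q ^ k"
    have 1: "qpoch a Q k = (- 1 / q ^ (2 * m + 1)) ^ k * Q ^ (k choose 2) * qpoch y Q k"
      unfolding a_def y_def using q Q by (intro qpoch_reflect) auto
    have "q * q ^ (m * 2) * (q * q ^ (m * 2)) = q * (q * Q ^ (2 * m))"
      by (simp add: Qm mult_ac flip: power_add)
    then have "y * Q ^ k = a * Q * Q ^ (2 * m + 1)"
      using q Q by (simp add: y_def a_def field_simps Qm Q_def power2_eq_square)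
    then have 2: "qpoch y Q k * qpoch (a * Q) Q (n - k) =
        qpoch (a * Q) Q (2 * m + 1) * qpoch y Q (n - (2 * m + 1))"
      using Q k m by (intro qpoch_exchange) auto
    have 3: "qpoch b Q k * qpoch (c * Q ^ k) Q (n - k) =
        qpoch (c * Q ^ k) Q m * qpoch (c * Q ^ m) Q (n - m)"
      unfolding b_def using Q k m by (intro qpoch_exchange) (auto simp: mult_ac)
    have 4: "qpoch (c * Q * Q ^ (n - k)) Q k * qpoch (b * Q) Q (n - k) =
        qpoch (c * Q * Q ^ m) Q (n - m) * qpoch (c * Q * Q ^ (n - k)) Q m"
      using qpoch_exchange[of Q "c * Q * Q ^ (n - k)" k "b * Q" "n - m" n] Q k m
      by (simp add: b_def mult_ac flip: power_add)
    have "q * (- 1 / q ^ (2 * m + 1)) = - 1 * (1 / Q ^ m)"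
      using q by (simp add: Qm)
    then have "q ^ k * (- 1 / q ^ (2 * m + 1)) ^ k = (- 1) ^ k * (1 / Q ^ m) ^ k"
      by (simp only: flip: power_mult_distrib)
    also have "(1 / Q ^ m) ^ k = (1 / Q ^ k) ^ m"
      by (simp add: power_one_over mult.commute flip: power_mult)
    finally have "q ^ k * (- 1 / q ^ (2 * m + 1)) ^ k = (- 1) ^ k * (1 / Q ^ k) ^ m" .
    moreover have "(1 / Q ^ k) ^ m * qpoch (c * Q ^ k) Q m = (\<Prod>i<m. 1 / Q ^ k - c * Q ^ i)"
    proof -
      have "1 / Q ^ k - c * Q ^ i = 1 / Q ^ k * (1 - c * Q ^ k * Q ^ i)" for i
        using Q by (simp add: field_simps)
      then show ?thesis
        by (simp only: qpoch_def prod.distrib prod_constant card_lessThan)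
    qed
    moreover have "qpoch (c * Q * Q ^ (n - k)) Q m =
        (\<Prod>i<m. 1 - c * Q * Q ^ n * Q ^ i * (1 / Q ^ k))"
      using Q k by (simp add: qpoch_def power_diff field_simps)
    moreover have "qpoch y Q (n - (2 * m + 1)) =
        (\<Prod>i<n - (2 * m + 1). 1 - q ^ (2 * m + 3) * Q ^ i * (1 / Q ^ k))"
      by (simp add: qpoch_def y_def Q_def power2_eq_square eval_nat_numeral mult_ac)
    ultimately have 5: "q ^ k * (- 1 / q ^ (2 * m + 1)) ^ k * qpoch (c * Q ^ k) Q m
        * qpoch y Q (n - (2 * m + 1)) * qpoch (c * Q * Q ^ (n - k)) Q m
        = (- 1) ^ k * poly p (1 / Q ^ k)"
      by (simp add: p_def poly_prod mult_ac)
    have "qbin Q n k * q ^ k * (qpoch a Q k * qpoch b Q k)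
        * (qpoch (a * Q) Q (n - k) * qpoch (b * Q) Q (n - k))
        * (qpoch (c * Q ^ k) Q (n - k) * qpoch (c * Q * Q ^ (n - k)) Q k)
      = qbin Q n k * q ^ k * (- 1 / q ^ (2 * m + 1)) ^ k * Q ^ (k choose 2)
        * (qpoch y Q k * qpoch (a * Q) Q (n - k))
        * (qpoch b Q k * qpoch (c * Q ^ k) Q (n - k))
        * (qpoch (c * Q * Q ^ (n - k)) Q k * qpoch (b * Q) Q (n - k))"
      unfolding 1 by (simp only: mult_ac)
    also have "\<dots> = K * Q ^ (k choose 2) * qbin Q n k *
        (q ^ k * (- 1 / q ^ (2 * m + 1)) ^ k * qpoch (c * Q ^ k) Q m
        * qpoch y Q (n - (2 * m + 1)) * qpoch (c * Q * Q ^ (n - k)) Q m)"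
      unfolding 2 3 4 K_def by (simp only: mult_ac)
    finally show ?thesis unfolding 5 by (simp only: mult_ac)
  qed
  then have "cleared_sum q n a b =
      K * (\<Sum>k\<le>n. (- 1) ^ k * Q ^ (k choose 2) * qbin Q n k * poly p (1 / Q ^ k))"
    unfolding cleared_sum_def c Q_def[symmetric] sum_distrib_left
    by (intro sum.cong refl) simp
  then show ?thesis
    unfolding b unfolding a_def[symmetric] q_difference_eq_0[OF Q deg] by simp
qed

text \<open>
  As \<open>a = Q\<^sup>-\<^sup>m\<close>, the factor \<open>(a; Q)\<^sub>k\<close> vanishes for \<open>k > m\<close> and \<open>(a Q; Q)\<^sub>n\<^sub>-\<^sub>k\<close>
  vanishes for \<open>k \<le> n - m\<close>; with \<open>2 m \<le> n\<close> these ranges cover all \<open>k\<close>.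
\<close>
lemma cleared_sum_even_eq_0:
  assumes q: "q \<noteq> 0" and m: "0 < m" "2 * m \<le> n"
  shows "cleared_sum q n (1 / q ^ (2 * m)) b = 0"
  unfolding cleared_sum_def
proof (intro sum.neutral ballI)
  fix k assume "k \<in> {..n}"
  show "qbin (q\<^sup>2) n k * q ^ k
        * (qpoch (1 / q ^ (2 * m)) (q\<^sup>2) k * qpoch b (q\<^sup>2) k)
        * (qpoch (1 / q ^ (2 * m) * q\<^sup>2) (q\<^sup>2) (n - k) * qpoch (b * q\<^sup>2) (q\<^sup>2) (n - k))
        * (qpoch (1 / q ^ (2 * m) * b * q * (q\<^sup>2) ^ k) (q\<^sup>2) (n - k)
           * qpoch (1 / q ^ (2 * m) * b * q * q\<^sup>2 * (q\<^sup>2) ^ (n - k)) (q\<^sup>2) k) = 0"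
  proof (cases "m < k")
    case True
    have "qpoch (1 / q ^ (2 * m)) (q\<^sup>2) k = 0"
      using q by (intro qpoch_eq_0[OF _ True]) (simp add: power_mult)
    then show ?thesis by simp
  next
    case False
    then have *: "m - 1 < n - k" using m by linarith
    have "q\<^sup>2 * (q\<^sup>2) ^ (m - 1) = q ^ (2 * m)"
      using m by (cases m) (simp_all add: power_mult power2_eq_square)
    then have "qpoch (1 / q ^ (2 * m) * q\<^sup>2) (q\<^sup>2) (n - k) = 0"
      using q by (intro qpoch_eq_0[OF _ *]) simp
    then show ?thesis by simp
  qed
qed

lemma cleared_sum_1: "cleared_sum q n 1 b = cleared_prod q n 1 b"
proof -
  have "qpoch 1 (q\<^sup>2) k = 0" if "k > 0" for k
    using that by (intro qpoch_eq_0[of _ _ 0]) auto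
  then have "cleared_sum q n 1 b = (\<Sum>k\<le>n. if k = 0 then
      qpoch (q\<^sup>2) (q\<^sup>2) n * (qpoch (b * q) (q\<^sup>2) n * qpoch (b * q * q) (q\<^sup>2) n) else 0)"
    unfolding cleared_sum_def by (intro sum.cong) (auto simp: power2_eq_square mult_ac)
  also have "\<dots> = qpoch (q\<^sup>2) (q\<^sup>2) n * qpoch (b * q) q (2 * n)"
    by (simp add: qpoch_square_split)
  also have "\<dots> = cleared_prod q n 1 b"
    using qpoch_split[of n "2 * n" "b * q" q]
    by (simp add: cleared_prod_def mult_ac flip: qpoch_times_minus)
  finally show ?thesis .
qed

text \<open>The product \<open>(a v, b v; p)\<^sub>k\<close> as a polynomial in \<open>a + b\<close> when \<open>a b = e\<close> is fixed.\<close>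
definition pair_poly :: "complex \<Rightarrow> complex \<Rightarrow> complex \<Rightarrow> nat \<Rightarrow> complex poly" where
  "pair_poly e v p k = (\<Prod>i<k. [:1 + e * (v * p ^ i)\<^sup>2, - v * p ^ i:])"

lemma poly_pair_poly:
  "poly (pair_poly (a * b) v p k) (a + b) = qpoch (a * v) p k * qpoch (b * v) p k"
  unfolding pair_poly_def qpoch_def poly_prod prod.distrib[symmetric]
  by (intro prod.cong refl) (simp add: algebra_simps power2_eq_square)

lemma degree_pair_poly: "degree (pair_poly e v p k) \<le> k"
  unfolding pair_poly_def by (rule degree_prod_linear_le) simp

text \<open>
  Interpolation in \<open>a + b\<close> at the nodes \<open>q\<^sup>-\<^sup>j + e q\<^sup>j\<close>, which the hypotheses make distinct.
\<close>
lemma cleared_identity_generic: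
  assumes q: "q \<noteq> 0" "qpoch (q\<^sup>2) (q\<^sup>2) n \<noteq> 0"
    and generic: "\<And>m. m \<le> 2 * n \<Longrightarrow> a * b * q ^ m \<noteq> 1"
  shows "cleared_sum q n a b = cleared_prod q n a b"
proof -
  define e where "e = a * b"
  define L where "L = (\<Sum>k\<le>n. smult (qbin (q\<^sup>2) n k * q ^ k *
      (qpoch (e * q * (q\<^sup>2) ^ k) (q\<^sup>2) (n - k)
       * qpoch (e * q * q\<^sup>2 * (q\<^sup>2) ^ (n - k)) (q\<^sup>2) k))
      (pair_poly e 1 (q\<^sup>2) k * pair_poly e (q\<^sup>2) (q\<^sup>2) (n - k)))"
  define R where "R = smult (qpoch (- q) q n * qpoch (e * q ^ Suc n) q n) (pair_poly e q q n)"
  have L: "poly L (x + y) = cleared_sum q n x y" if "x * y = e" for x y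
    unfolding L_def cleared_sum_def that[symmetric] poly_sum
    by (intro sum.cong refl) (simp add: poly_pair_poly mult_ac)
  have R: "poly R (x + y) = cleared_prod q n x y" if "x * y = e" for x y
    unfolding R_def cleared_prod_def that[symmetric] by (simp add: poly_pair_poly mult_ac)

  \<comment> \<open>Two nodes differ by \<open>(q\<^sup>l - q\<^sup>j) (1 - e q\<^sup>j\<^sup>+\<^sup>l)\<close> up to a power of \<open>q\<close>; the hypotheses
    exclude that either factor vanishes.\<close>
  define s where "s j = 1 / q ^ j + e * q ^ j" for j
  have "s j \<noteq> s l" if "j < l" "l \<le> n" for j l
  proof
    assume "s j = s l"
    moreover have "(s j - s l) * q ^ (j + l) = (q ^ l - q ^ j) * (1 - e * q ^ (j + l))"
      using q by (simp add: s_def field_simps power_add)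
    ultimately have "(q ^ l - q ^ j) * (1 - e * q ^ (j + l)) = 0" by simp
    moreover have "e * q ^ (j + l) \<noteq> 1"
      using generic[of "j + l"] that by (simp add: e_def)
    ultimately have "q ^ l = q ^ j" by simp
    then have "q ^ (l - j) = 1"
      using that q by (simp add: power_diff)
    then have "(q\<^sup>2) ^ (l - j) = 1"
      by (simp flip: power_mult add: mult.commute[of 2]) (simp add: power_mult)
    moreover have "Suc (l - j - 1) = l - j"
      using that by simp
    ultimately have "q\<^sup>2 * (q\<^sup>2) ^ (l - j - 1) = 1"
      by (metis power_Suc)
    then show False
      using qpoch_nonzero_factor[OF q(2), of "l - j - 1"] that by linarith
  qed
  then have "inj_on s {..n}"
    by (intro linorder_inj_onI) auto
  then have card: "card (s ` {..n}) = Suc n"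
    by (simp add: card_image)
  have "L = R"
  proof (rule poly_eqI_degree)
    show "degree L < card (s ` {..n})"
      unfolding card less_Suc_eq_le L_def
    proof (intro degree_sum_le order.trans[OF degree_smult_le] order.trans[OF degree_mult_le])
      show "degree (pair_poly e 1 (q\<^sup>2) k) + degree (pair_poly e (q\<^sup>2) (q\<^sup>2) (n - k)) \<le> n"
        if "k \<in> {..n}" for k
        using degree_pair_poly[of e 1 "q\<^sup>2" k] degree_pair_poly[of e "q\<^sup>2" "q\<^sup>2" "n - k"] that
        by simp
    qed simp
    show "degree R < card (s ` {..n})"
      unfolding card less_Suc_eq_le R_def
      by (intro order.trans[OF degree_smult_le] degree_pair_poly)
  next
    fix x assume "x \<in> s ` {..n}"
    then obtain j where j: "j \<le> n" "x = 1 / q ^ j + e * q ^ j"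
      by (auto simp: s_def)
    have [simp]: "1 / q ^ j * (e * q ^ j) = e" using q by simp
    have "cleared_sum q n (1 / q ^ j) (e * q ^ j) = cleared_prod q n (1 / q ^ j) (e * q ^ j)"
    proof (cases "j = 0")
      case True
      then show ?thesis by (simp add: cleared_sum_1)
    next
      case False
      have "1 / q ^ j * q * q ^ (j - 1) = 1"
        using False q by (cases j) simp_all
      then have "qpoch (1 / q ^ j * q) q n = 0"
        using False j by (intro qpoch_eq_0[of _ _ "j - 1"]) auto
      then have "cleared_prod q n (1 / q ^ j) (e * q ^ j) = 0"
        by (simp add: cleared_prod_def)
      moreover have "cleared_sum q n (1 / q ^ j) (e * q ^ j) = 0"
      proof (cases "even j")
        case True
        then obtain m where "j = 2 * m" by (elim evenE)
        then show ?thesis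
          using cleared_sum_even_eq_0[OF q(1), of m n] False j by simp
      next
        case odd: False
        then obtain m where "j = 2 * m + 1" by (elim oddE)
        then show ?thesis
          using cleared_sum_odd_eq_0[OF q(1), of m n] j by simp
      qed
      ultimately show ?thesis by simp
    qed
    then show "poly L x = poly R x"
      unfolding j(2) L[OF \<open>1 / q ^ j * (e * q ^ j) = e\<close>] R[OF \<open>1 / q ^ j * (e * q ^ j) = e\<close>] .
  qed
  then show ?thesis
    using L[of a b] R[of a b] by (simp add: e_def)
qed

text \<open>
  For fixed \<open>q\<close> and \<open>a\<close> only finitely many \<open>b\<close> fail to be generic, so every \<open>b\<close> is a
  limit of generic values.
\<close>
lemma cleared_identity:
  assumes q: "q \<noteq> 0" "qpoch (q\<^sup>2) (q\<^sup>2) n \<noteq> 0"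
  shows "cleared_sum q n a b = cleared_prod q n a b"
proof -
  have "\<forall>\<^sub>F x in at b. a * x * q ^ m \<noteq> 1" for m
    using eventually_neq_at_within[of "1 / (a * q ^ m)" b UNIV]
    by eventually_elim (use q(1) in \<open>auto simp: eq_divide_eq mult_ac split: if_splits\<close>)
  then have "\<forall>\<^sub>F x in at b. \<forall>m\<in>{..2 * n}. a * x * q ^ m \<noteq> 1"
    by (intro eventually_ball_finite) auto
  then have eq: "\<forall>\<^sub>F x in at b. cleared_sum q n a x = cleared_prod q n a x"
    by eventually_elim (use cleared_identity_generic[OF q] in auto)
  have "continuous (at b) (cleared_sum q n a)"
    unfolding cleared_sum_def[abs_def] by (intro continuous_intros)
  then have "(cleared_sum q n a \<longlongrightarrow> cleared_sum q n a b) (at b)"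
    by (simp add: continuous_within)
  moreover have "continuous (at b) (cleared_prod q n a)"
    unfolding cleared_prod_def[abs_def] by (intro continuous_intros)
  then have "(cleared_prod q n a \<longlongrightarrow> cleared_prod q n a b) (at b)"
    by (simp add: continuous_within)
  then have "(cleared_sum q n a \<longlongrightarrow> cleared_prod q n a b) (at b)"
    using tendsto_cong[OF eq] by simp
  ultimately show ?thesis
    using tendsto_unique[OF at_neq_bot] by blast
qed


section \<open>The hypergeometric series\<close>

lemma qpoch_reflect_complement:
  assumes "Q \<noteq> 0" "x \<noteq> 0" "k \<le> n"
  shows "qpoch (1 / (x * Q ^ n)) Q k =
      (- 1 / (x * Q ^ n)) ^ k * Q ^ (k choose 2) * qpoch (x * Q * Q ^ (n - k)) Q k"
  using qpoch_reflect[of Q "x * Q ^ n" k] assms by (simp add: power_diff mult_ac)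

text \<open>
  Four factors are reflected: those with parameters \<open>Q\<^sup>-\<^sup>n\<close> and \<open>Q\<^sup>-\<^sup>n / c\<close> in the numerator,
  those with \<open>Q\<^sup>-\<^sup>n / a\<close> and \<open>Q\<^sup>-\<^sup>n / b\<close> in the denominator. The signs and quadratic
  powers cancel; because \<open>c = a b q\<close>, the linear powers combine with \<open>Q\<^sup>k\<close> to \<open>q\<^sup>k\<close>.
\<close>
lemma phi43_term:
  assumes q: "q \<noteq> 0" and ab: "a \<noteq> 0" "b \<noteq> 0" and k: "k \<le> n" and Q: "Q = q\<^sup>2"
    and nz: "qpoch Q Q n \<noteq> 0" "qpoch (a * Q) Q n \<noteq> 0" "qpoch (b * Q) Q n \<noteq> 0"
      "qpoch (a * b * q) Q n \<noteq> 0"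
  shows "qpochs [1 / Q ^ n, a, b, 1 / (a * b * q * Q ^ n)] Q k * Q ^ k
       / qpochs [Q, 1 / (a * Q ^ n), 1 / (b * Q ^ n), a * b * q] Q k
     = qbin Q n k * q ^ k
        * (qpoch a Q k * qpoch b Q k)
        * (qpoch (a * Q) Q (n - k) * qpoch (b * Q) Q (n - k))
        * (qpoch (a * b * q * Q ^ k) Q (n - k) * qpoch (a * b * q * Q * Q ^ (n - k)) Q k)
       / (qpoch (a * Q) Q n * qpoch (b * Q) Q n * qpoch (a * b * q) Q n)"
proof -
  define c where "c = a * b * q"
  have Q0: "Q \<noteq> 0" using q Q by simp
  have c0: "c \<noteq> 0" using q ab by (simp add: c_def)
  define g where "g = (\<lambda>x. qpoch (x * Q * Q ^ (n - k)) Q k)"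
  \<comment> \<open>Reflection turns \<open>(1 / (x Q\<^sup>n); Q)\<^sub>k\<close> into the monomial \<open>r x\<close> times \<open>g x\<close>.\<close>
  define r where "r = (\<lambda>x. (- 1 / (x * Q ^ n)) ^ k * Q ^ (k choose 2))"
  have refl: "qpoch (1 / (x * Q ^ n)) Q k = r x * g x" if "x \<noteq> 0" for x
    unfolding r_def g_def using Q0 that k by (rule qpoch_reflect_complement)
  have r0: "r x \<noteq> 0" if "x \<noteq> 0" for x
    using that Q0 by (simp add: r_def)
  have split: "qpoch (x * Q) Q n = qpoch (x * Q) Q (n - k) * g x" for x
    using qpoch_split[of "n - k" n "x * Q" Q] k by (simp add: g_def)
  have bin: "qpoch Q Q n = qbin Q n k * qpoch Q Q k * qpoch Q Q (n - k)"
    using qbin_qpoch[of Q k "n - k"] k by simp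
  have csplit: "qpoch c Q n = qpoch c Q k * qpoch (c * Q ^ k) Q (n - k)"
    using k by (rule qpoch_split)
  have g1: "g 1 = qbin Q n k * qpoch Q Q k"
    using split[of 1] bin nz(1) by simp
  have rr: "r 1 * r c * Q ^ k = q ^ k * (r a * r b)"
  proof -
    have "- 1 / (1 * Q ^ n) * (- 1 / (c * Q ^ n)) * Q =
        q * (- 1 / (a * Q ^ n) * (- 1 / (b * Q ^ n)))"
      using q ab Q0 by (simp add: c_def Q power2_eq_square field_simps)
    then have "(- 1 / (1 * Q ^ n)) ^ k * (- 1 / (c * Q ^ n)) ^ k * Q ^ k =
        q ^ k * ((- 1 / (a * Q ^ n)) ^ k * (- 1 / (b * Q ^ n)) ^ k)"
      by (simp only: flip: power_mult_distrib)
    moreover have "r 1 * r c * Q ^ k = Q ^ (k choose 2) * Q ^ (k choose 2) *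
        ((- 1 / (1 * Q ^ n)) ^ k * (- 1 / (c * Q ^ n)) ^ k * Q ^ k)"
      unfolding r_def by (simp only: mult_ac)
    ultimately show ?thesis
      unfolding r_def by (simp only: mult_ac)
  qed
  have "qpochs [1 / Q ^ n, a, b, 1 / (c * Q ^ n)] Q k * Q ^ k
       / qpochs [Q, 1 / (a * Q ^ n), 1 / (b * Q ^ n), c] Q k
     = (r 1 * r c * Q ^ k) * (g 1 * qpoch a Q k * qpoch b Q k * g c)
       / (qpoch Q Q k * (r a * g a) * (r b * g b) * qpoch c Q k)"
    using refl[of 1] refl[OF ab(1)] refl[OF ab(2)] refl[OF c0] by (simp add: qpochs_def mult_ac)
  also have "\<dots> = (r a * r b * qpoch Q Q k) * (qbin Q n k * q ^ k * qpoch a Q k * qpoch b Q k * g c)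
       / ((r a * r b * qpoch Q Q k) * (g a * g b * qpoch c Q k))"
    unfolding rr g1 by (simp only: mult_ac)
  also have "\<dots> = qbin Q n k * q ^ k * qpoch a Q k * qpoch b Q k * g c / (g a * g b * qpoch c Q k)"
    using r0 ab qpoch_nonzero_le[OF nz(1) k] by simp
  also have "\<dots> = qbin Q n k * q ^ k
        * (qpoch a Q k * qpoch b Q k)
        * (qpoch (a * Q) Q (n - k) * qpoch (b * Q) Q (n - k))
        * (qpoch (c * Q ^ k) Q (n - k) * g c)
       / (qpoch (a * Q) Q n * qpoch (b * Q) Q n * qpoch c Q n)"
    using nz unfolding c_def[symmetric] split csplit by (simp add: field_simps)
  finally show ?thesis unfolding c_def g_def .
qed

theorem mainTheorem7:
  fixes n :: nat and q a b :: complex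
  assumes "q \<noteq> 0" and "a \<noteq> 0" and "b \<noteq> 0"
    and "\<forall>k\<le>n. qpochs [q^2, q powi (- 2 * int n) / a, q powi (- 2 * int n) / b, a * b * q] (q^2) k \<noteq> 0"
    and "qpoch (a * b * q) q n \<noteq> 0"
    and "qpochs [a * q^2, b * q^2] (q^2) n \<noteq> 0"
  shows "phi43 (q powi (- 2 * int n)) a b (q powi (- 1 - 2 * int n) / (a * b))
           (q powi (- 2 * int n) / a) (q powi (- 2 * int n) / b) (a * b * q) (q^2) (q^2)
       = qpochs [a * q, b * q, - q] q n * qpoch (a * b * q^2) (q^2) n
         / (qpoch (a * b * q) q n * qpochs [a * q^2, b * q^2] (q^2) n)"
proof -
  define Q where "Q = q\<^sup>2"
  define c where "c = a * b * q"
  have nz: "qpoch Q Q n \<noteq> 0" "qpoch c Q n \<noteq> 0" "qpoch (a * Q) Q n \<noteq> 0" "qpoch (b * Q) Q n \<noteq> 0"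
    using assms(4,6) by (auto simp: qpochs_def Q_def c_def)
  have Q0: "Q \<noteq> 0" using assms(1) by (simp add: Q_def)
  have pow: "q powi (- 2 * int n) = Q powi (- int n)" "Q powi (- int n) = 1 / Q ^ n"
      "q powi (- 1 - 2 * int n) = 1 / (q * Q ^ n)"
  proof -
    show *: "Q powi (- int n) = 1 / Q ^ n"
      by (simp add: power_int_minus divide_inverse)
    have "q powi (- 2 * int n) = 1 / q powi (int (2 * n))"
      by (simp add: power_int_minus divide_inverse)
    also have "\<dots> = 1 / Q ^ n"
      unfolding power_int_of_nat by (simp add: Q_def power_mult)
    finally show "q powi (- 2 * int n) = Q powi (- int n)" using * by simp
    have "q powi (- 1 - 2 * int n) = q powi (- int (2 * n + 1))"
      by simp
    also have "\<dots> = 1 / q ^ (2 * n + 1)"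
      unfolding power_int_minus power_int_of_nat by (simp add: divide_inverse)
    finally show "q powi (- 1 - 2 * int n) = 1 / (q * Q ^ n)"
      by (simp add: Q_def power_mult)
  qed
  have "phi43 (q powi (- 2 * int n)) a b (q powi (- 1 - 2 * int n) / (a * b))
           (q powi (- 2 * int n) / a) (q powi (- 2 * int n) / b) (a * b * q) (q^2) (q^2)
      = (\<Sum>k\<le>n. qpochs [1 / Q ^ n, a, b, 1 / (c * Q ^ n)] Q k * Q ^ k
           / qpochs [Q, 1 / (a * Q ^ n), 1 / (b * Q ^ n), c] Q k)"
    unfolding pow(1) Q_def[symmetric] phi43_terminating[OF Q0] unfolding pow(2,3) c_def
    by (simp add: mult_ac)
  also have "\<dots> = cleared_sum q n a b / (qpoch (a * Q) Q n * qpoch (b * Q) Q n * qpoch c Q n)"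
    unfolding cleared_sum_def sum_divide_distrib Q_def[symmetric] c_def
    by (intro sum.cong refl phi43_term) (use assms nz in \<open>auto simp: Q_def c_def\<close>)
  also have "cleared_sum q n a b = cleared_prod q n a b"
    using cleared_identity[OF assms(1)] nz(1) by (simp add: Q_def)
  also have "cleared_prod q n a b / (qpoch (a * Q) Q n * qpoch (b * Q) Q n * qpoch c Q n) =
      qpochs [a * q, b * q, - q] q n * (qpoch (c * q ^ n) q n / qpoch c Q n)
      / qpochs [a * Q, b * Q] Q n"
    by (simp add: cleared_prod_def qpochs_def c_def mult_ac)
  \<comment> \<open>Both cross products equal \<open>(c; q)\<^sub>2\<^sub>n\<close>, cut in halves or split by parity.\<close>
  also have "qpoch (c * q ^ n) q n / qpoch c Q n = qpoch (a * b * Q) Q n / qpoch c q n"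
  proof -
    have "qpoch c q n * qpoch (c * q ^ n) q n = qpoch c Q n * qpoch (a * b * Q) Q n"
      using qpoch_square_split[of c q n] qpoch_split[of n "2 * n" c q]
      by (simp add: c_def Q_def power2_eq_square mult_ac)
    then show ?thesis
      using nz(2) assms(5) by (simp add: field_simps c_def)
  qed
  finally show ?thesis
    by (simp add: Q_def c_def)
qed

end
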